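(* Assume the Boolean Ultrafilter Theorem: every proper filter on a given Boolean algebra is contained in an ultrafilter. Then there is a monad isomorphism between the prime open filter monad $\mathbb{S}=(\Sigma,m,e)$ and the prime closed filter monad $\mathbb{P}=(\mathfrak{P},n,d)$ on $\mathbf{Top}$.
   Context: $\mathbf{Top}$ is the category of topological spaces and continuous maps. A morphism of monads $(T,\mu,\eta)\to(M,n,e)$ is a natural transformation $\alpha:T\to M$ with $\alpha\cdot\eta=e$ and $\alpha\cdot\mu=n\cdot(\alpha M\cdot T\alpha)$; a monad isomorphism is an invertible one. Prime open filter monad $\mathbb{S}=(\Sigma,m,e)$: for a space $X$ with topology $\tau$, $\Sigma X$ is the set of prime open filters, i.e. proper filters $\mathcal{G}$ in the lattice $\tau$ such that $O\cup U\in\mathcal{G}$ with $O,U$ open implies $O\in\mathcal{G}$ or $U\in\mathcal{G}$. The topology on $\Sigma X$ has basis $\{O^{\times}\mid O\subseteq X\text{ open}\}$ with $O^{\times}=\{\mathcal{G}\in\Sigma X\mid O\in\mathcal{G}\}$. For continuous $f:X\to Y$, $\Sigma f(\mathcal{G})=\{B\subseteq Y\text{ open}\mid f^{-1}(B)\in\mathcal{G}\}$. $m_X(\mathfrak{X})=\{O\text{ open}\mid O^{\times}\in\mathfrak{X}\}$ for $\mathfrak{X}\in\Sigma\Sigma X$, and $e_X(x)=\{O\text{ open}\mid x\in O\}$. Prime closed filter monad $\mathbb{P}=(\mathfrak{P},n,d)$: let $\mathcal{B}_X$ be the collection of closed subsets of $X$. $\mathfrak{P}X$ is the set of prime closed filters,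 i.e. proper filters $\mathcal{F}$ in the lattice $\mathcal{B}_X$ such that $H\cup G\in\mathcal{F}$ with $H,G$ closed implies $H\in\mathcal{F}$ or $G\in\mathcal{F}$. A base for the closed sets of $\mathfrak{P}X$ is $\{H^{\times}\mid H\in\mathcal{B}_X\}$ with $H^{\times}=\{\mathcal{F}\in\mathfrak{P}X\mid H\in\mathcal{F}\}$. For continuous $f:X\to Y$, $\mathfrak{P}f(\mathcal{F})=\{B\in\mathcal{B}_Y\mid f^{-1}(B)\in\mathcal{F}\}$. $n_X(\mathfrak{X})=\{H\in\mathcal{B}_X\setminus\{\emptyset\}\mid H^{\times}\in\mathfrak{X}\}$ for $\mathfrak{X}\in\mathfrak{P}\mathfrak{P}X$, and $d_X(x)=\{C\in\mathcal{B}_X\mid x\in C\}$. *)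

theory Defs
  imports "HOL-Analysis.Analysis"
begin

section \<open>The Boolean Ultrafilter Theorem\<close>

definition proper_filter_on ::
    "('c \<Rightarrow> 'c \<Rightarrow> 'c) \<Rightarrow> ('c \<Rightarrow> 'c \<Rightarrow> bool) \<Rightarrow> 'c set \<Rightarrow> bool" where
  "proper_filter_on meet le F \<longleftrightarrow>
     F \<noteq> {} \<and> F \<noteq> UNIV \<and>
     (\<forall>x\<in>F. \<forall>y. le x y \<longrightarrow> y \<in> F) \<and> (\<forall>x\<in>F. \<forall>y\<in>F. meet x y \<in> F)"

definition ultrafilter_on ::
    "('c \<Rightarrow> 'c \<Rightarrow> 'c) \<Rightarrow> ('c \<Rightarrow> 'c \<Rightarrow> bool) \<Rightarrow> 'c set \<Rightarrow> bool" where
  "ultrafilter_on meet le U \<longleftrightarrow>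
     proper_filter_on meet le U \<and>
     (\<forall>F. proper_filter_on meet le F \<and> U \<subseteq> F \<longrightarrow> F = U)"

text \<open>The quantifiers range over all Boolean algebra structures whose carrier is the type
  \<open>'c\<close>; a quantifier over all carriers is not available inside a formula.\<close>

definition boolean_ultrafilter_theorem :: "'c itself \<Rightarrow> bool" where
  "boolean_ultrafilter_theorem (_ :: 'c itself) \<longleftrightarrow>
     (\<forall>diff compl meet le less join bt tp.
        class.boolean_algebra diff compl meet le less join (bt :: 'c) tp \<longrightarrow>
        (\<forall>F. proper_filter_on meet le F \<longrightarrow>
             (\<exists>U. ultrafilter_on meet le U \<and> F \<subseteq> U)))"


section \<open>Natural transformations and morphisms of monads on spaces\<close>

text \<open>The category of spaces has the values of type \<open>'a topology\<close>, for all types \<open>'a\<close>, as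
  objects, and as morphisms from \<open>X\<close> to \<open>Y\<close> the functions that are continuous from \<open>X\<close> to
  \<open>Y\<close>, identified when they agree on \<open>topspace X\<close>. A functor is a polymorphic object map together
  with a polymorphic map on morphisms. HOL has no variables ranging over polymorphic functions, so
  the following predicates take as separate arguments the type instances of each functor and each
  transformation that the laws mention. Below, all of these are instances of one constant, and the
  statements hold for arbitrary types.

  \<open>F\<close>, \<open>G\<close>, \<open>\<alpha>\<close> are the instances at \<open>'a\<close>; \<open>F'\<close>, \<open>G'\<close>, \<open>\<alpha>'\<close> those at \<open>'b\<close>; \<open>Fm\<close> and \<open>Gm\<close> act
  on maps from \<open>'a\<close>-spaces to \<open>'b\<close>-spaces.\<close>

definition natural_transformation ::
    "('a topology \<Rightarrow> 'fa topology) \<times> ('b topology \<Rightarrow> 'fb topology) \<times>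
       ('a topology \<Rightarrow> 'b topology \<Rightarrow> ('a \<Rightarrow> 'b) \<Rightarrow> 'fa \<Rightarrow> 'fb) \<Rightarrow>
     ('a topology \<Rightarrow> 'ga topology) \<times> ('b topology \<Rightarrow> 'gb topology) \<times>
       ('a topology \<Rightarrow> 'b topology \<Rightarrow> ('a \<Rightarrow> 'b) \<Rightarrow> 'ga \<Rightarrow> 'gb) \<Rightarrow>
     ('a topology \<Rightarrow> 'fa \<Rightarrow> 'ga) \<times> ('b topology \<Rightarrow> 'fb \<Rightarrow> 'gb) \<Rightarrow> bool" where
  "natural_transformation = (\<lambda>(F, F', Fm) (G, G', Gm) (\<alpha>, \<alpha>').
     (\<forall>X. continuous_map (F X) (G X) (\<alpha> X)) \<and>
     (\<forall>Y. continuous_map (F' Y) (G' Y) (\<alpha>' Y)) \<and>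
     (\<forall>X Y f. continuous_map X Y f \<longrightarrow>
        (\<forall>p\<in>topspace (F X). \<alpha>' Y (Fm X Y f p) = Gm X Y f (\<alpha> X p))))"

text \<open>A morphism of monads from \<open>(T, \<mu>, \<eta>)\<close> to \<open>(M, n, e)\<close>. Here \<open>TmM\<close> is the action of \<open>T\<close> on
  maps from \<open>T X\<close> to \<open>M X\<close> and \<open>\<alpha>M\<close> is the instance of \<open>\<alpha>\<close> at the spaces \<open>M X\<close>, for \<open>X\<close> of type
  \<open>'a topology\<close>.\<close>

definition monad_morphism ::
    "('a topology \<Rightarrow> 'ta topology) \<times> ('b topology \<Rightarrow> 'tb topology) \<times>
       ('ta topology \<Rightarrow> 'tta topology) \<times>
       ('a topology \<Rightarrow> 'b topology \<Rightarrow> ('a \<Rightarrow> 'b) \<Rightarrow> 'ta \<Rightarrow> 'tb) \<times>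
       ('ta topology \<Rightarrow> 'ma topology \<Rightarrow> ('ta \<Rightarrow> 'ma) \<Rightarrow> 'tta \<Rightarrow> 'tma) \<times>
       ('a topology \<Rightarrow> 'tta \<Rightarrow> 'ta) \<times> ('a topology \<Rightarrow> 'a \<Rightarrow> 'ta) \<Rightarrow>
     ('a topology \<Rightarrow> 'ma topology) \<times> ('b topology \<Rightarrow> 'mb topology) \<times>
       ('a topology \<Rightarrow> 'b topology \<Rightarrow> ('a \<Rightarrow> 'b) \<Rightarrow> 'ma \<Rightarrow> 'mb) \<times>
       ('a topology \<Rightarrow> 'mma \<Rightarrow> 'ma) \<times> ('a topology \<Rightarrow> 'a \<Rightarrow> 'ma) \<Rightarrow>
     ('a topology \<Rightarrow> 'ta \<Rightarrow> 'ma) \<times> ('b topology \<Rightarrow> 'tb \<Rightarrow> 'mb) \<times>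
       ('ma topology \<Rightarrow> 'tma \<Rightarrow> 'mma) \<Rightarrow> bool" where
  "monad_morphism = (\<lambda>(T, T', TT, Tm, TmM, \<mu>, \<eta>) (M, M', Mm, n, e) (\<alpha>, \<alpha>', \<alpha>M).
     natural_transformation (T, T', Tm) (M, M', Mm) (\<alpha>, \<alpha>') \<and>
     (\<forall>X. \<forall>x\<in>topspace X. \<alpha> X (\<eta> X x) = e X x) \<and>
     (\<forall>X. \<forall>p\<in>topspace (TT (T X)).
        \<alpha> X (\<mu> X p) = n X (\<alpha>M (M X) (TmM (T X) (M X) (\<alpha> X) p))))"


section \<open>Prime filters in a lattice of sets\<close>

definition prime_filter :: "'a set set \<Rightarrow> 'a set set \<Rightarrow> bool" where
  "prime_filter L F \<longleftrightarrow>
     F \<subseteq> L \<and> F \<noteq> {} \<and> F \<noteq> L \<and>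
     (\<forall>A\<in>F. \<forall>B\<in>L. A \<subseteq> B \<longrightarrow> B \<in> F) \<and>
     (\<forall>A\<in>F. \<forall>B\<in>F. A \<inter> B \<in> F) \<and>
     (\<forall>A\<in>L. \<forall>B\<in>L. A \<union> B \<in> F \<longrightarrow> A \<in> F \<or> B \<in> F)"


section \<open>The prime open filter monad\<close>

definition prime_open_filters :: "'a topology \<Rightarrow> 'a set set set" where
  "prime_open_filters X = {G. prime_filter {U. openin X U} G}"

definition open_cross :: "'a topology \<Rightarrow> 'a set \<Rightarrow> 'a set set set" where
  "open_cross X U = {G \<in> prime_open_filters X. U \<in> G}"

definition prime_open_space :: "'a topology \<Rightarrow> 'a set set topology" where
  "prime_open_space X =
     topology (arbitrary union_of (\<lambda>W. \<exists>U. openin X U \<and> W = open_cross X U))"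

definition prime_open_map ::
    "'a topology \<Rightarrow> 'b topology \<Rightarrow> ('a \<Rightarrow> 'b) \<Rightarrow> 'a set set \<Rightarrow> 'b set set" where
  "prime_open_map X Y f G = {B. openin Y B \<and> f -` B \<inter> topspace X \<in> G}"

definition prime_open_mult :: "'a topology \<Rightarrow> 'a set set set set \<Rightarrow> 'a set set" where
  "prime_open_mult X \<GG> = {U. openin X U \<and> open_cross X U \<in> \<GG>}"

definition prime_open_unit :: "'a topology \<Rightarrow> 'a \<Rightarrow> 'a set set" where
  "prime_open_unit X x = {U. openin X U \<and> x \<in> U}"


section \<open>The prime closed filter monad\<close>

definition prime_closed_filters :: "'a topology \<Rightarrow> 'a set set set" where
  "prime_closed_filters X = {F. prime_filter {H. closedin X H} F}"

definition closed_cross :: "'a topology \<Rightarrow> 'a set \<Rightarrow> 'a set set set" where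
  "closed_cross X H = {F \<in> prime_closed_filters X. H \<in> F}"

text \<open>The closed sets are the intersections of subfamilies of the base; the empty subfamily gives
  the whole space. The lemma \<open>closedin_prime_closed_space\<close> below confirms this reading.\<close>

definition prime_closed_space :: "'a topology \<Rightarrow> 'a set set topology" where
  "prime_closed_space X =
     topology (\<lambda>W. W \<subseteq> prime_closed_filters X \<and>
       (\<exists>\<H> \<subseteq> {H. closedin X H}.
          prime_closed_filters X - W = prime_closed_filters X \<inter> (\<Inter>H\<in>\<H>. closed_cross X H)))"

definition prime_closed_map ::
    "'a topology \<Rightarrow> 'b topology \<Rightarrow> ('a \<Rightarrow> 'b) \<Rightarrow> 'a set set \<Rightarrow> 'b set set" where
  "prime_closed_map X Y f F = {B. closedin Y B \<and> f -` B \<inter> topspace X \<in> F}"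

definition prime_closed_mult :: "'a topology \<Rightarrow> 'a set set set set \<Rightarrow> 'a set set" where
  "prime_closed_mult X \<FF> = {H. closedin X H \<and> H \<noteq> {} \<and> closed_cross X H \<in> \<FF>}"

definition prime_closed_unit :: "'a topology \<Rightarrow> 'a \<Rightarrow> 'a set set" where
  "prime_closed_unit X x = {C. closedin X C \<and> x \<in> C}"


section \<open>The two transformations\<close>

text \<open>The complement of a prime filter is a prime ideal, and taking complements in \<open>X\<close> turns a
  prime ideal of open sets into a prime filter of closed sets, and conversely. The existential
  quantifier over transformations is rendered by these polymorphic constants, as their instances at
  different types occur in one law.\<close>

definition open_to_closed :: "'a topology \<Rightarrow> 'a set set \<Rightarrow> 'a set set" where
  "open_to_closed X G = {H. closedin X H \<and> topspace X - H \<notin> G}"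

definition closed_to_open :: "'a topology \<Rightarrow> 'a set set \<Rightarrow> 'a set set" where
  "closed_to_open X F = {U. openin X U \<and> topspace X - U \<notin> F}"


section \<open>The intended topologies\<close>

lemma openin_prime_open_space:
  "openin (prime_open_space X) =
     arbitrary union_of (\<lambda>W. \<exists>U. openin X U \<and> W = open_cross X U)"
proof -
  have "open_cross X U \<inter> open_cross X V = open_cross X (U \<inter> V)"
    if "openin X U" "openin X V" for U V
  proof -
    have "U \<inter> V \<in> G \<longleftrightarrow> U \<in> G \<and> V \<in> G" if G: "prime_filter {U. openin X U} G" for G
    proof
      have up: "\<And>A B. A \<in> G \<Longrightarrow> openin X B \<Longrightarrow> A \<subseteq> B \<Longrightarrow> B \<in> G"
        using G unfolding prime_filter_def by simp
      show "U \<in> G \<and> V \<in> G" if "U \<inter> V \<in> G"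
        using up[OF that] \<open>openin X U\<close> \<open>openin X V\<close> by simp
      show "U \<inter> V \<in> G" if "U \<in> G \<and> V \<in> G"
        using G that unfolding prime_filter_def by simp
    qed
    then show ?thesis
      by (auto simp: open_cross_def prime_open_filters_def)
  qed
  then have "istopology (arbitrary union_of (\<lambda>W. \<exists>U. openin X U \<and> W = open_cross X U))"
    by (intro istopology_base) (metis openin_Int)
  then show ?thesis
    by (simp add: prime_open_space_def topology_inverse')
qed

lemma topspace_prime_open_space: "topspace (prime_open_space X) = prime_open_filters X"
proof -
  have "topspace X \<in> G" if "G \<in> prime_open_filters X" for G
  proof -
    from that obtain U where "U \<in> G" "openin X U"
      unfolding prime_open_filters_def prime_filter_def by blast
    with that show ?thesis
      unfolding prime_open_filters_def prime_filter_def
      using openin_subset[of X U] openin_topspace[of X] by blast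
  qed
  then have "open_cross X (topspace X) = prime_open_filters X"
    unfolding open_cross_def by blast
  then have "openin (prime_open_space X) (prime_open_filters X)"
    unfolding openin_prime_open_space
    by (intro arbitrary_union_of_inc exI[of _ "topspace X"]) simp
  moreover have "W \<subseteq> prime_open_filters X" if "openin (prime_open_space X) W" for W
    using that unfolding openin_prime_open_space
    by (auto simp: union_of_def arbitrary_def open_cross_def)
  ultimately show ?thesis
    by (meson openin_subset openin_topspace subset_antisym)
qed

lemma openin_prime_closed_space:
  "openin (prime_closed_space X) W \<longleftrightarrow>
     W \<subseteq> prime_closed_filters X \<and>
     (\<exists>\<H> \<subseteq> {H. closedin X H}.
        prime_closed_filters X - W = prime_closed_filters X \<inter> (\<Inter>H\<in>\<H>. closed_cross X H))"
proof -
  let ?P = "prime_closed_filters X"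
  let ?open = "\<lambda>W. W \<subseteq> ?P \<and>
    (\<exists>\<H> \<subseteq> {H. closedin X H}. ?P - W = ?P \<inter> (\<Inter>H\<in>\<H>. closed_cross X H))"
  have cross_Un: "closed_cross X H \<union> closed_cross X K = closed_cross X (H \<union> K)"
    if "closedin X H" "closedin X K" for H K
  proof -
    have "H \<union> K \<in> F \<longleftrightarrow> H \<in> F \<or> K \<in> F" if F: "prime_filter {H. closedin X H} F" for F
    proof
      have up: "\<And>A B. A \<in> F \<Longrightarrow> closedin X B \<Longrightarrow> A \<subseteq> B \<Longrightarrow> B \<in> F"
        using F unfolding prime_filter_def by simp
      show "H \<in> F \<or> K \<in> F" if "H \<union> K \<in> F"
        using F that \<open>closedin X H\<close> \<open>closedin X K\<close> unfolding prime_filter_def by simp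
      show "H \<union> K \<in> F" if "H \<in> F \<or> K \<in> F"
        using that up[of H "H \<union> K"] up[of K "H \<union> K"]
          closedin_Un[OF \<open>closedin X H\<close> \<open>closedin X K\<close>] by blast
    qed
    then show ?thesis
      by (auto simp: closed_cross_def prime_closed_filters_def)
  qed
  have "istopology ?open"
    unfolding istopology_def
  proof (intro conjI allI impI)
    fix V W assume V: "?open V" and W: "?open W"
    from V obtain \<H> where \<H>: "\<H> \<subseteq> {H. closedin X H}"
      "?P - V = ?P \<inter> (\<Inter>H\<in>\<H>. closed_cross X H)" by blast
    from W obtain \<K> where \<K>: "\<K> \<subseteq> {H. closedin X H}"
      "?P - W = ?P \<inter> (\<Inter>H\<in>\<K>. closed_cross X H)" by blast
    let ?HK = "(\<lambda>(H, K). H \<union> K) ` (\<H> \<times> \<K>)"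
    have "?P - V \<inter> W = (?P - V) \<union> (?P - W)" by blast
    also have "\<dots> = ?P \<inter> (\<Inter>H\<in>\<H>. \<Inter>K\<in>\<K>. closed_cross X H \<union> closed_cross X K)"
      unfolding \<H>(2) \<K>(2) by blast
    also have "\<dots> = ?P \<inter> (\<Inter>H\<in>\<H>. \<Inter>K\<in>\<K>. closed_cross X (H \<union> K))"
      using \<H>(1) \<K>(1) by (auto simp: cross_Un[symmetric] subset_eq)
    finally have "?P - V \<inter> W = ?P \<inter> (\<Inter>L\<in>?HK. closed_cross X L)" by auto
    moreover have "?HK \<subseteq> {H. closedin X H}" using \<H>(1) \<K>(1) by auto
    ultimately show "\<exists>\<L> \<subseteq> {H. closedin X H}. ?P - V \<inter> W = ?P \<inter> (\<Inter>H\<in>\<L>. closed_cross X H)"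
      by blast
    show "V \<inter> W \<subseteq> ?P" using V by blast
  next
    fix \<W> assume *: "\<forall>W\<in>\<W>. ?open W"
    then show "\<Union>\<W> \<subseteq> ?P" by blast
    from * obtain h where h: "\<And>W. W \<in> \<W> \<Longrightarrow> h W \<subseteq> {H. closedin X H}"
      "\<And>W. W \<in> \<W> \<Longrightarrow> ?P - W = ?P \<inter> (\<Inter>H\<in>h W. closed_cross X H)" by metis
    have "?P - \<Union>\<W> = ?P \<inter> (\<Inter>W\<in>\<W>. ?P - W)" by blast
    also have "\<dots> = ?P \<inter> (\<Inter>W\<in>\<W>. ?P \<inter> (\<Inter>H\<in>h W. closed_cross X H))"
      using h(2) by simp
    also have "\<dots> = ?P \<inter> (\<Inter>H\<in>(\<Union>W\<in>\<W>. h W). closed_cross X H)" by blast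
    finally show "\<exists>\<L> \<subseteq> {H. closedin X H}. ?P - \<Union>\<W> = ?P \<inter> (\<Inter>H\<in>\<L>. closed_cross X H)"
      using h(1) by (intro exI[of _ "\<Union>W\<in>\<W>. h W"]) blast
  qed
  then show ?thesis
    by (simp add: prime_closed_space_def topology_inverse')
qed

lemma topspace_prime_closed_space: "topspace (prime_closed_space X) = prime_closed_filters X"
proof -
  have "closed_cross X {} = {}"
    unfolding closed_cross_def prime_closed_filters_def prime_filter_def by blast
  then have "openin (prime_closed_space X) (prime_closed_filters X)"
    unfolding openin_prime_closed_space by (intro conjI exI[of _ "{{}}"]) auto
  then show ?thesis
    by (meson openin_prime_closed_space openin_subset openin_topspace subset_antisym)
qed

lemma closedin_prime_closed_space:
  "closedin (prime_closed_space X) C \<longleftrightarrow>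
     (\<exists>\<H> \<subseteq> {H. closedin X H}.
        C = prime_closed_filters X \<inter> (\<Inter>H\<in>\<H>. closed_cross X H))"
proof
  assume "closedin (prime_closed_space X) C"
  then have C: "C \<subseteq> prime_closed_filters X"
    and "openin (prime_closed_space X) (prime_closed_filters X - C)"
    by (simp_all add: closedin_def topspace_prime_closed_space)
  from this(2)[unfolded openin_prime_closed_space double_diff[OF C order_refl]]
  show "\<exists>\<H> \<subseteq> {H. closedin X H}.
      C = prime_closed_filters X \<inter> (\<Inter>H\<in>\<H>. closed_cross X H)"
    by (rule conjunct2)
next
  assume *: "\<exists>\<H> \<subseteq> {H. closedin X H}.
      C = prime_closed_filters X \<inter> (\<Inter>H\<in>\<H>. closed_cross X H)"
  then have C: "C \<subseteq> prime_closed_filters X" by blast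
  have "openin (prime_closed_space X) (prime_closed_filters X - C)"
    unfolding openin_prime_closed_space double_diff[OF C order_refl]
    using * by (intro conjI Diff_subset)
  with C show "closedin (prime_closed_space X) C"
    by (simp add: closedin_def topspace_prime_closed_space)
qed

end

theory Submission
  imports Defs
begin

text \<open>Complementation in a space is an order-reversing bijection between the lattice of its open
  sets and the lattice of its closed sets. It carries the prime filters of either lattice to prime
  ideals of the other, and the complement of a prime ideal is again a prime filter. This gives
  mutually inverse bijections between the prime open and the prime closed filters of a space
  (\<open>prime_filter_complementary_lattice\<close>, \<open>closed_to_open_open_to_closed\<close>,
  \<open>open_to_closed_closed_to_open\<close>).

  Everything else follows from how the bijections treat basic sets: a prime open filter \<open>G\<close> with
  image \<open>F\<close> satisfies \<open>H \<in> F\<close>, for closed \<open>H\<close>, exactly if the complement of \<open>H\<close> is missing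
  from \<open>G\<close>. Hence the
  basic closed set of \<open>H\<close> corresponds to the complement of the basic open set of the complement of
  \<open>H\<close> (\<open>open_to_closed_vimage_closed_cross\<close> and \<open>closed_to_open_vimage_open_cross\<close>). So both
  bijections are continuous. The multiplications are read off from membership of basic sets, so the
  same two facts show that the bijections respect them. Naturality holds because preimages commute
  with complements.\<close>

section \<open>Duality of prime filters\<close>

text \<open>Complementation reverses inclusion and exchanges union with intersection. Thus primeness of
  the given filter makes the new family closed under intersection, and closure of the given filter
  under intersection makes the new one prime.\<close>

lemma prime_filter_complementary_lattice:
  assumes F: "prime_filter L F"
    and LK: "\<And>A. A \<in> L \<Longrightarrow> A \<subseteq> S \<and> S - A \<in> K"
    and KL: "\<And>A. A \<in> K \<Longrightarrow> S - A \<in> L"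
    and K_Int: "\<And>A B. A \<in> K \<Longrightarrow> B \<in> K \<Longrightarrow> A \<inter> B \<in> K"
  shows "prime_filter K {H \<in> K. S - H \<notin> F}"
proof -
  have FL: "F \<subseteq> L" and ne: "F \<noteq> {}" "F \<noteq> L"
    and up: "\<And>A B. A \<in> F \<Longrightarrow> B \<in> L \<Longrightarrow> A \<subseteq> B \<Longrightarrow> B \<in> F"
    and inter: "\<And>A B. A \<in> F \<Longrightarrow> B \<in> F \<Longrightarrow> A \<inter> B \<in> F"
    and prime: "\<And>A B. A \<in> L \<Longrightarrow> B \<in> L \<Longrightarrow> A \<union> B \<in> F \<Longrightarrow> A \<in> F \<or> B \<in> F"
    using F unfolding prime_filter_def by auto
  have compl2: "S - (S - A) = A" if "A \<in> L" for A
    using LK[OF that] by blast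
  obtain A where A: "A \<in> F" using ne by blast
  obtain B where B: "B \<in> L" "B \<notin> F" using ne FL by blast
  have "S - A \<in> K" "S - (S - A) \<in> F"
    using A FL LK compl2 by auto
  moreover have "S - B \<in> K" "S - (S - B) \<notin> F"
    using B LK compl2 by auto
  moreover have "S - D \<notin> F" if "C \<in> K" "D \<in> K" "S - C \<notin> F" "C \<subseteq> D" for C D
    using that up[of "S - D" "S - C"] KL by blast
  moreover have "S - C \<inter> D \<notin> F" if "C \<in> K" "D \<in> K" "S - C \<notin> F" "S - D \<notin> F" for C D
    using that prime[of "S - C" "S - D"] KL by (auto simp: Diff_Int)
  moreover have "S - C \<notin> F \<or> S - D \<notin> F" if "S - (C \<union> D) \<notin> F" for C D
    using that inter[of "S - C" "S - D"] by (auto simp: Diff_Un)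
  ultimately show ?thesis
    unfolding prime_filter_def using K_Int by blast
qed

lemma open_to_closed_in_prime_closed_filters:
  assumes "G \<in> prime_open_filters X"
  shows "open_to_closed X G \<in> prime_closed_filters X"
  using prime_filter_complementary_lattice[of "{U. openin X U}" G "topspace X" "{H. closedin X H}"]
    assms openin_subset
  by (auto simp: prime_open_filters_def prime_closed_filters_def open_to_closed_def)

lemma closed_to_open_in_prime_open_filters:
  assumes "F \<in> prime_closed_filters X"
  shows "closed_to_open X F \<in> prime_open_filters X"
  using prime_filter_complementary_lattice[of "{H. closedin X H}" F "topspace X" "{U. openin X U}"]
    assms closedin_subset
  by (auto simp: prime_open_filters_def prime_closed_filters_def closed_to_open_def)

lemma closed_to_open_open_to_closed:
  assumes "G \<in> prime_open_filters X"
  shows "closed_to_open X (open_to_closed X G) = G"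
proof -
  have "G \<subseteq> {U. openin X U}"
    using assms by (simp add: prime_open_filters_def prime_filter_def)
  then show ?thesis
    by (auto simp: closed_to_open_def open_to_closed_def double_diff openin_subset)
qed

lemma open_to_closed_closed_to_open:
  assumes "F \<in> prime_closed_filters X"
  shows "open_to_closed X (closed_to_open X F) = F"
proof -
  have "F \<subseteq> {H. closedin X H}"
    using assms by (simp add: prime_closed_filters_def prime_filter_def)
  then show ?thesis
    by (auto simp: closed_to_open_def open_to_closed_def double_diff closedin_subset)
qed


section \<open>Basic sets and continuity\<close>

lemma openin_open_cross:
  assumes "openin X U"
  shows "openin (prime_open_space X) (open_cross X U)"
  unfolding openin_prime_open_space using assms by (intro arbitrary_union_of_inc) blast

lemma closedin_closed_cross:
  assumes "closedin X H"
  shows "closedin (prime_closed_space X) (closed_cross X H)"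
  unfolding closedin_prime_closed_space
  using assms by (intro exI[of _ "{H}"]) (auto simp: closed_cross_def)

lemma open_cross_topspace: "open_cross X (topspace X) = prime_open_filters X"
proof -
  have "topspace X \<in> G" if "prime_filter {U. openin X U} G" for G
    using that openin_subset[of X] openin_topspace[of X]
    unfolding prime_filter_def by blast
  then show ?thesis
    by (auto simp: open_cross_def prime_open_filters_def)
qed

lemma closed_cross_empty: "closed_cross X {} = {}"
  unfolding closed_cross_def prime_closed_filters_def prime_filter_def by blast

lemma open_to_closed_vimage_closed_cross:
  assumes "closedin X H"
  shows "open_to_closed X -` closed_cross X H \<inter> prime_open_filters X =
         prime_open_filters X - open_cross X (topspace X - H)"
  using assms open_to_closed_in_prime_closed_filters
  by (auto simp: closed_cross_def open_cross_def open_to_closed_def)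

lemma closed_to_open_vimage_open_cross:
  assumes "openin X U"
  shows "closed_to_open X -` open_cross X U \<inter> prime_closed_filters X =
         prime_closed_filters X - closed_cross X (topspace X - U)"
  using assms closed_to_open_in_prime_open_filters
  by (auto simp: closed_cross_def open_cross_def closed_to_open_def)

text \<open>A closed set of prime closed filters is an intersection of basic closed sets, and these have
  closed preimages.\<close>

lemma continuous_map_open_to_closed:
  "continuous_map (prime_open_space X) (prime_closed_space X) (open_to_closed X)"
  unfolding continuous_map_closedin
proof (intro conjI allI impI funcsetI)
  fix G assume "G \<in> topspace (prime_open_space X)"
  then show "open_to_closed X G \<in> topspace (prime_closed_space X)"
    by (simp add: topspace_prime_open_space topspace_prime_closed_space
        open_to_closed_in_prime_closed_filters)
next
  fix C assume "closedin (prime_closed_space X) C"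
  then obtain \<H> where \<H>: "\<H> \<subseteq> {H. closedin X H}"
    and C: "C = prime_closed_filters X \<inter> (\<Inter>H\<in>\<H>. closed_cross X H)"
    unfolding closedin_prime_closed_space by blast
  have "{G \<in> prime_open_filters X. open_to_closed X G \<in> C} =
      {G \<in> prime_open_filters X. \<forall>H\<in>\<H>. open_to_closed X G \<in> closed_cross X H}"
    unfolding C using open_to_closed_in_prime_closed_filters by blast
  also have "\<dots> = prime_open_filters X - (\<Union>H\<in>\<H>. open_cross X (topspace X - H))"
    using \<H> open_to_closed_vimage_closed_cross by blast
  finally have "{G \<in> topspace (prime_open_space X). open_to_closed X G \<in> C} =
      topspace (prime_open_space X) - (\<Union>H\<in>\<H>. open_cross X (topspace X - H))"
    by (simp add: topspace_prime_open_space)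
  moreover have "openin (prime_open_space X) (\<Union>H\<in>\<H>. open_cross X (topspace X - H))"
    using \<H> by (intro openin_Union) (auto intro!: openin_open_cross)
  ultimately show "closedin (prime_open_space X)
      {G \<in> topspace (prime_open_space X). open_to_closed X G \<in> C}"
    by auto
qed

lemma continuous_map_closed_to_open:
  "continuous_map (prime_closed_space X) (prime_open_space X) (closed_to_open X)"
  unfolding continuous_map_def
proof (intro conjI allI impI funcsetI)
  fix F assume "F \<in> topspace (prime_closed_space X)"
  then show "closed_to_open X F \<in> topspace (prime_open_space X)"
    by (simp add: topspace_prime_open_space topspace_prime_closed_space
        closed_to_open_in_prime_open_filters)
next
  fix W assume "openin (prime_open_space X) W"
  then obtain \<U> where \<U>: "\<U> \<subseteq> {V. \<exists>U. openin X U \<and> V = open_cross X U}" and W: "W = \<Union>\<U>"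
    unfolding openin_prime_open_space union_of_def arbitrary_def by blast
  have "openin (prime_closed_space X) {F \<in> prime_closed_filters X. closed_to_open X F \<in> V}"
    if V: "V \<in> \<U>" for V
  proof -
    obtain U where U: "openin X U" "V = open_cross X U" using V \<U> by blast
    then have "{F \<in> prime_closed_filters X. closed_to_open X F \<in> V} =
        topspace (prime_closed_space X) - closed_cross X (topspace X - U)"
      using closed_to_open_vimage_open_cross[OF U(1)] by (auto simp: topspace_prime_closed_space)
    then show ?thesis
      using U closedin_closed_cross[of X "topspace X - U"] by auto
  qed
  moreover have "{F \<in> prime_closed_filters X. closed_to_open X F \<in> W} =
      (\<Union>V\<in>\<U>. {F \<in> prime_closed_filters X. closed_to_open X F \<in> V})"
    unfolding W by blast
  ultimately show "openin (prime_closed_space X)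
      {F \<in> topspace (prime_closed_space X). closed_to_open X F \<in> W}"
    unfolding topspace_prime_closed_space by auto
qed


section \<open>Naturality and the monad laws\<close>

lemma vimage_complement_continuous_map:
  assumes "continuous_map X Y f"
  shows "f -` (topspace Y - B) \<inter> topspace X = topspace X - f -` B \<inter> topspace X"
  using continuous_map_funspace[OF assms] by blast

lemma openin_vimage_continuous_map:
  assumes "continuous_map X Y f" "openin Y U"
  shows "openin X (f -` U \<inter> topspace X)"
  using openin_continuous_map_preimage[OF assms] by (simp add: vimage_def Int_def conj_commute)

lemma closedin_vimage_continuous_map:
  assumes "continuous_map X Y f" "closedin Y H"
  shows "closedin X (f -` H \<inter> topspace X)"
  using closedin_continuous_map_preimage[OF assms] by (simp add: vimage_def Int_def conj_commute)

lemma open_to_closed_natural: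
  assumes f: "continuous_map X Y f"
  shows "open_to_closed Y (prime_open_map X Y f G) = prime_closed_map X Y f (open_to_closed X G)"
  using closedin_vimage_continuous_map[OF f]
  by (auto simp: open_to_closed_def prime_open_map_def prime_closed_map_def
      vimage_complement_continuous_map[OF f])

lemma closed_to_open_natural:
  assumes f: "continuous_map X Y f"
  shows "closed_to_open Y (prime_closed_map X Y f F) = prime_open_map X Y f (closed_to_open X F)"
  using openin_vimage_continuous_map[OF f]
  by (auto simp: closed_to_open_def prime_open_map_def prime_closed_map_def
      vimage_complement_continuous_map[OF f])

lemma open_to_closed_unit:
  assumes "x \<in> topspace X"
  shows "open_to_closed X (prime_open_unit X x) = prime_closed_unit X x"
  using assms by (auto simp: open_to_closed_def prime_open_unit_def prime_closed_unit_def)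

lemma closed_to_open_unit:
  assumes "x \<in> topspace X"
  shows "closed_to_open X (prime_closed_unit X x) = prime_open_unit X x"
  using assms by (auto simp: closed_to_open_def prime_open_unit_def prime_closed_unit_def)

text \<open>Both sides contain a nonempty closed set \<open>H\<close> exactly if the basic open set of the complement
  of \<open>H\<close> is missing from the given filter. The empty set lies in neither: the basic open set of the
  whole space is everything, hence is an element of every filter.\<close>

lemma open_to_closed_mult:
  assumes p: "p \<in> prime_open_filters (prime_open_space X)"
  shows "open_to_closed X (prime_open_mult X p) =
    prime_closed_mult X (open_to_closed (prime_closed_space X)
      (prime_open_map (prime_open_space X) (prime_closed_space X) (open_to_closed X) p))"
    (is "?lhs = ?rhs")
proof -
  have top: "open_cross X (topspace X) \<in> p"
  proof -
    have "p \<in> open_cross (prime_open_space X) (topspace (prime_open_space X))"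
      unfolding open_cross_topspace by (fact p)
    then have "topspace (prime_open_space X) \<in> p"
      unfolding open_cross_def by blast
    then show ?thesis
      by (simp add: open_cross_topspace topspace_prime_open_space)
  qed
  have vimage: "open_to_closed X -` (prime_closed_filters X - closed_cross X H) \<inter>
      prime_open_filters X = open_cross X (topspace X - H)" if "closedin X H" for H
    using that open_to_closed_in_prime_closed_filters
    by (auto simp: closed_cross_def open_cross_def open_to_closed_def)
  have opn: "openin (prime_closed_space X) (prime_closed_filters X - closed_cross X H)"
    if "closedin X H" for H
    using closedin_closed_cross[OF that] by (simp add: closedin_def topspace_prime_closed_space)
  have rhs: "H \<in> ?rhs \<longleftrightarrow> closedin X H \<and> H \<noteq> {} \<and> open_cross X (topspace X - H) \<notin> p" for H
  proof (cases "closedin X H")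
    case True
    then show ?thesis
      by (simp add: prime_closed_mult_def open_to_closed_def[of "prime_closed_space X"]
          prime_open_map_def topspace_prime_open_space topspace_prime_closed_space
          vimage opn closedin_closed_cross)
  qed (simp add: prime_closed_mult_def)
  have lhs: "H \<in> ?lhs \<longleftrightarrow> closedin X H \<and> open_cross X (topspace X - H) \<notin> p" for H
    by (auto simp: open_to_closed_def prime_open_mult_def)
  show ?thesis
  proof (rule set_eqI)
    fix H
    show "H \<in> ?lhs \<longleftrightarrow> H \<in> ?rhs"
      unfolding lhs rhs using top by (cases "H = {}") simp_all
  qed
qed

text \<open>Dually, an open set \<open>U\<close> lies in either side exactly if the basic closed set of the complement
  of \<open>U\<close> is missing from the given filter. For \<open>U\<close> the whole space, which the closed multiplication
  treats separately, that basic closed set is empty, hence in no proper filter.\<close>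

lemma closed_to_open_mult:
  assumes p: "p \<in> prime_closed_filters (prime_closed_space X)"
  shows "closed_to_open X (prime_closed_mult X p) =
    prime_open_mult X (closed_to_open (prime_open_space X)
      (prime_closed_map (prime_closed_space X) (prime_open_space X) (closed_to_open X) p))"
    (is "?lhs = ?rhs")
proof -
  have empty: "closed_cross X {} \<notin> p"
  proof -
    have "{} \<notin> p"
      using p closed_cross_empty[of "prime_closed_space X"] by (auto simp: closed_cross_def)
    then show ?thesis
      by (simp add: closed_cross_empty)
  qed
  have vimage: "closed_to_open X -` (prime_open_filters X - open_cross X U) \<inter>
      prime_closed_filters X = closed_cross X (topspace X - U)" if "openin X U" for U
    using that closed_to_open_in_prime_open_filters
    by (auto simp: closed_cross_def open_cross_def closed_to_open_def)
  have cls: "closedin (prime_open_space X) (prime_open_filters X - open_cross X U)"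
    if "openin X U" for U
    using openin_open_cross[OF that] by (metis openin_closedin_eq topspace_prime_open_space)
  have rhs: "U \<in> ?rhs \<longleftrightarrow> openin X U \<and> closed_cross X (topspace X - U) \<notin> p" for U
  proof (cases "openin X U")
    case True
    then show ?thesis
      by (simp add: prime_open_mult_def closed_to_open_def[of "prime_open_space X"]
          prime_closed_map_def topspace_prime_open_space topspace_prime_closed_space
          vimage cls openin_open_cross)
  qed (simp add: prime_open_mult_def)
  have lhs: "U \<in> ?lhs \<longleftrightarrow> openin X U \<and> closed_cross X (topspace X - U) \<notin> p" for U
  proof -
    have "topspace X - U \<noteq> {}" if "closed_cross X (topspace X - U) \<in> p"
      using that empty by metis
    then show ?thesis
      by (auto simp: closed_to_open_def prime_closed_mult_def)
  qed
  show ?thesis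
    by (rule set_eqI) (simp only: lhs rhs)
qed


section \<open>The isomorphism of monads\<close>

theorem proposition33:
  assumes "boolean_ultrafilter_theorem TYPE('c)"
  shows
    "monad_morphism
       (prime_open_space :: 'a topology \<Rightarrow> _, prime_open_space :: 'b topology \<Rightarrow> _,
        prime_open_space, prime_open_map, prime_open_map, prime_open_mult, prime_open_unit)
       (prime_closed_space, prime_closed_space, prime_closed_map,
        prime_closed_mult, prime_closed_unit)
       (open_to_closed, open_to_closed, open_to_closed) \<and>
     monad_morphism
       (prime_closed_space :: 'a topology \<Rightarrow> _, prime_closed_space :: 'b topology \<Rightarrow> _,
        prime_closed_space, prime_closed_map, prime_closed_map,
        prime_closed_mult, prime_closed_unit)
       (prime_open_space, prime_open_space, prime_open_map, prime_open_mult, prime_open_unit)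
       (closed_to_open, closed_to_open, closed_to_open) \<and>
     (\<forall>X :: 'a topology.
        (\<forall>G\<in>topspace (prime_open_space X). closed_to_open X (open_to_closed X G) = G) \<and>
        (\<forall>F\<in>topspace (prime_closed_space X). open_to_closed X (closed_to_open X F) = F))"
  unfolding monad_morphism_def natural_transformation_def prod.case
    topspace_prime_open_space topspace_prime_closed_space
  by (intro conjI allI ballI impI
      continuous_map_open_to_closed continuous_map_closed_to_open
      open_to_closed_natural closed_to_open_natural open_to_closed_unit closed_to_open_unit
      open_to_closed_mult closed_to_open_mult
      closed_to_open_open_to_closed open_to_closed_closed_to_open)

end
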